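(* Let $(W,S)$ be a Coxeter system and let $(X,\mathrm{ht})$ be a bounded quasiparabolic $W$-set with odd stabilizers (i.e. which is odd). Then the Möbius function of $(X,\le)$, where $\le$ is the Bruhat order, is described as follows. If $x\not\le y$, then $\mu(x,y)=0$. If $x\le y$, then $\mu(x,y)=(-1)^{\mathrm{ht}(y)-\mathrm{ht}(x)}$, unless there exists a chain $$x<r_1x<r_2r_1x<\cdots<y,\qquad r_i\in R(W),$$ (each term after the first being obtained from the previous one by applying a reflection) in which the height increases by an even amount at some step; in that case, $\mu(x,y)=0$.
   Context: Coxeter systems $(W,S)$ have finite rank; $R(W)$ is the set of reflections, i.e. conjugates in $W$ of elements of $S$; $\ell$ is the length function. A scaled $W$-set is a pair $(X,\mathrm{ht})$ with $X$ a (left) $W$-set and $\mathrm{ht}:X\to\mathbb Z$ a function with $|\mathrm{ht}(sx)-\mathrm{ht}(x)|\le 1$ for all $s\in S$, $x\in X$. A quasiparabolic $W$-set is a scaled $W$-set such that (QP1) for all $r\in R(W)$, $x\in X$, if $\mathrm{ht}(rx)=\mathrm{ht}(x)$ then $rx=x$; and (QP2) for all $r\in R(W)$, $x\in X$, $s\in S$, if $\mathrm{ht}(rx)>\mathrm{ht}(x)$ and $\mathrm{ht}(srx)<\mathrm{ht}(sx)$, then $rx=sx$. It is even if $wx=x$ ($w\in W$, $x\in X$) implies that $\ell(w)$ is even, and odd otherwise. "Bounded" means that the height function is bounded from below or bounded from above. The Bruhat order on a quasiparabolic $W$-set is the weakest partial order such that for $x\in X$, $r\in R(W)$, $x\le rx$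 iff $\mathrm{ht}(x)\le\mathrm{ht}(rx)$ (i.e. the reflexive-transitive closure of the relations $x<rx$ with $r \in R(W)$, $\mathrm{ht}(x)<\mathrm{ht}(rx)$). *)

theory Defs
  imports "HOL-Algebra.Group_Action" "HOL-Algebra.Generated_Groups" "HOL-Algebra.Multiplicative_Group"
begin

section \<open>Group presentations\<close>

text \<open>A letter \<open>(s, True)\<close> stands for the generator \<open>s\<close>, and \<open>(s, False)\<close> for its formal inverse.\<close>

type_synonym 'a signed_word = "('a \<times> bool) list"

definition eval_word :: "('a, 'm) monoid_scheme \<Rightarrow> 'a signed_word \<Rightarrow> 'a" where
  "eval_word W u =
     foldr (\<lambda>(s, b) g. (if b then s else inv\<^bsub>W\<^esub> s) \<otimes>\<^bsub>W\<^esub> g) u \<one>\<^bsub>W\<^esub>"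

text \<open>\<open>presented_eq A Rel u v\<close>: the words \<open>u\<close> and \<open>v\<close> represent the same element of the abstract
  group with generators \<open>A\<close> and relators \<open>Rel\<close>.\<close>

inductive presented_eq ::
    "'a set \<Rightarrow> 'a signed_word set \<Rightarrow> 'a signed_word \<Rightarrow> 'a signed_word \<Rightarrow> bool"
  for A Rel where
  refl: "presented_eq A Rel u u"
| sym: "presented_eq A Rel u v \<Longrightarrow> presented_eq A Rel v u"
| trans: "presented_eq A Rel u v \<Longrightarrow> presented_eq A Rel v w \<Longrightarrow> presented_eq A Rel u w"
| cancel: "s \<in> A \<Longrightarrow> presented_eq A Rel (u @ [(s, b), (s, \<not> b)] @ v) (u @ v)"
| relator: "q \<in> Rel \<Longrightarrow> presented_eq A Rel (u @ q @ v) (u @ v)"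

definition has_presentation ::
    "('a, 'm) monoid_scheme \<Rightarrow> 'a set \<Rightarrow> 'a signed_word set \<Rightarrow> bool" where
  "has_presentation W A Rel \<longleftrightarrow>
     A \<subseteq> carrier W \<and> generate W A = carrier W \<and>
     (\<forall>u v. u \<in> lists (A \<times> UNIV) \<longrightarrow> v \<in> lists (A \<times> UNIV) \<longrightarrow>
        (eval_word W u = eval_word W v \<longleftrightarrow> presented_eq A Rel u v))"


section \<open>Coxeter systems of finite rank\<close>

text \<open>The relators \<open>(s t)^m(s,t)\<close>, where \<open>m(s,t)\<close> is the order of \<open>s t\<close> in \<open>W\<close>.
  The library's \<open>group.ord\<close> is \<open>0\<close> on elements of infinite order, which yields the empty
  (hence vacuous) relator, as required when \<open>m(s,t) = \<infinity>\<close>.\<close>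

definition coxeter_relators :: "('a, 'm) monoid_scheme \<Rightarrow> 'a set \<Rightarrow> 'a signed_word set" where
  "coxeter_relators W S =
     {concat (replicate (group.ord W (s \<otimes>\<^bsub>W\<^esub> t)) [(s, True), (t, True)]) | s t. s \<in> S \<and> t \<in> S}"

definition coxeter_system :: "('a, 'm) monoid_scheme \<Rightarrow> 'a set \<Rightarrow> bool" where
  "coxeter_system W S \<longleftrightarrow>
     group W \<and> finite S \<and> S \<subseteq> carrier W \<and> (\<forall>s\<in>S. group.ord W s = 2) \<and>
     has_presentation W S (coxeter_relators W S)"

definition reflections :: "('a, 'm) monoid_scheme \<Rightarrow> 'a set \<Rightarrow> 'a set" where
  "reflections W S = {w \<otimes>\<^bsub>W\<^esub> s \<otimes>\<^bsub>W\<^esub> inv\<^bsub>W\<^esub> w | w s. w \<in> carrier W \<and> s \<in> S}"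

definition coxeter_length :: "('a, 'm) monoid_scheme \<Rightarrow> 'a set \<Rightarrow> 'a \<Rightarrow> nat" where
  "coxeter_length W S w =
     (LEAST n. \<exists>ss \<in> lists S. length ss = n \<and> foldr (\<lambda>s g. s \<otimes>\<^bsub>W\<^esub> g) ss \<one>\<^bsub>W\<^esub> = w)"


section \<open>Quasiparabolic sets\<close>

text \<open>A \<open>W\<close>-set is given by its carrier \<open>E\<close> and its action \<open>act\<close>, with \<open>act w x\<close> for \<open>w x\<close>.\<close>

definition scaled_W_set ::
    "('a, 'm) monoid_scheme \<Rightarrow> 'a set \<Rightarrow> 'b set \<Rightarrow> ('a \<Rightarrow> 'b \<Rightarrow> 'b) \<Rightarrow> ('b \<Rightarrow> int) \<Rightarrow> bool" where
  "scaled_W_set W S E act ht \<longleftrightarrow>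
     group_action W E act \<and> (\<forall>s\<in>S. \<forall>x\<in>E. \<bar>ht (act s x) - ht x\<bar> \<le> 1)"

definition quasiparabolic ::
    "('a, 'm) monoid_scheme \<Rightarrow> 'a set \<Rightarrow> 'b set \<Rightarrow> ('a \<Rightarrow> 'b \<Rightarrow> 'b) \<Rightarrow> ('b \<Rightarrow> int) \<Rightarrow> bool" where
  "quasiparabolic W S E act ht \<longleftrightarrow>
     scaled_W_set W S E act ht \<and>
     (\<forall>r\<in>reflections W S. \<forall>x\<in>E. ht (act r x) = ht x \<longrightarrow> act r x = x) \<and>
     (\<forall>r\<in>reflections W S. \<forall>x\<in>E. \<forall>s\<in>S.
        ht (act r x) > ht x \<and> ht (act s (act r x)) < ht (act s x) \<longrightarrow> act r x = act s x)"

definition even_W_set ::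
    "('a, 'm) monoid_scheme \<Rightarrow> 'a set \<Rightarrow> 'b set \<Rightarrow> ('a \<Rightarrow> 'b \<Rightarrow> 'b) \<Rightarrow> bool" where
  "even_W_set W S E act \<longleftrightarrow>
     (\<forall>w\<in>carrier W. \<forall>x\<in>E. act w x = x \<longrightarrow> even (coxeter_length W S w))"

definition odd_W_set ::
    "('a, 'm) monoid_scheme \<Rightarrow> 'a set \<Rightarrow> 'b set \<Rightarrow> ('a \<Rightarrow> 'b \<Rightarrow> 'b) \<Rightarrow> bool" where
  "odd_W_set W S E act \<longleftrightarrow> \<not> even_W_set W S E act"

definition bounded_height :: "'b set \<Rightarrow> ('b \<Rightarrow> int) \<Rightarrow> bool" where
  "bounded_height E ht \<longleftrightarrow> bdd_below (ht ` E) \<or> bdd_above (ht ` E)"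


section \<open>The Bruhat order\<close>

definition bruhat_order ::
    "('a, 'm) monoid_scheme \<Rightarrow> 'a set \<Rightarrow> 'b set \<Rightarrow> ('a \<Rightarrow> 'b \<Rightarrow> 'b) \<Rightarrow> ('b \<Rightarrow> int) \<Rightarrow> 'b rel" where
  "bruhat_order W S E act ht =
     {(x, act r x) | x r. x \<in> E \<and> r \<in> reflections W S \<and> ht x < ht (act r x)}\<^sup>* \<inter> E \<times> E"

text \<open>Chains \<open>x < r\<^sub>1 x < r\<^sub>2 r\<^sub>1 x < \<dots>\<close>, given by the nonempty list of their members.\<close>

definition reflection_chain ::
    "('a, 'm) monoid_scheme \<Rightarrow> 'a set \<Rightarrow> 'b set \<Rightarrow> ('a \<Rightarrow> 'b \<Rightarrow> 'b) \<Rightarrow> ('b \<Rightarrow> int) \<Rightarrow> 'b list \<Rightarrow> bool"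
  where
  "reflection_chain W S E act ht cs \<longleftrightarrow>
     cs \<noteq> [] \<and> set cs \<subseteq> E \<and>
     successively
       (\<lambda>u v. (u, v) \<in> bruhat_order W S E act ht \<and> u \<noteq> v \<and> (\<exists>r\<in>reflections W S. v = act r u)) cs"


section \<open>The Moebius function of a locally finite poset\<close>

text \<open>A poset is given by its reflexive order relation; its underlying set is the field.\<close>

definition locally_finite_order :: "'b rel \<Rightarrow> bool" where
  "locally_finite_order r \<longleftrightarrow>
     Partial_order r \<and> (\<forall>x y. finite {z. (x, z) \<in> r \<and> (z, y) \<in> r})"

text \<open>The usual recursion \<open>\<mu>(x,x) = 1\<close> and \<open>\<mu>(x,y) = - (\<Sum>x \<le> z < y. \<mu>(x,z))\<close> for \<open>x < y\<close>.
  If \<open>r\<close> is not a locally finite partial order, \<open>\<mu>\<close> has the junk value \<open>0\<close> everywhere, so that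
  \<open>\<mu>(x,x) = 1\<close> for some \<open>x\<close> already implies that \<open>\<mu>\<close> is the genuine Moebius function.\<close>

function moebius :: "'b rel \<Rightarrow> 'b \<Rightarrow> 'b \<Rightarrow> int" where
  "moebius r x y =
     (if locally_finite_order r \<and> (x, y) \<in> r then
        if x = y then 1
        else - (\<Sum>z\<in>{z. (x, z) \<in> r \<and> (z, y) \<in> r \<and> z \<noteq> y}. moebius r x z)
      else 0)"
  by pat_completeness auto

termination
proof (relation "measure (\<lambda>(r, x, y). card {z. (x, z) \<in> r \<and> (z, y) \<in> r})")
  fix r :: "'b rel" and x y z
  assume lf: "locally_finite_order r \<and> (x, y) \<in> r"
    and z: "z \<in> {z. (x, z) \<in> r \<and> (z, y) \<in> r \<and> z \<noteq> y}"
  have po: "refl_on (Field r) r" "trans r" "antisym r"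
    using lf partial_order_onD[of "Field r" r] by (simp_all add: locally_finite_order_def)
  have "(y, y) \<in> r"
    using lf po(1) by (auto intro: refl_onD FieldI2)
  then have "{w. (x, w) \<in> r \<and> (w, z) \<in> r} \<subset> {w. (x, w) \<in> r \<and> (w, y) \<in> r}"
    using lf z transD[OF po(2)] antisymD[OF po(3)] by blast
  then show "((r, x, z), r, x, y) \<in> measure (\<lambda>(r, x, y). card {z. (x, z) \<in> r \<and> (z, y) \<in> r})"
    using lf by (simp add: locally_finite_order_def psubset_card_mono)
qed simp

declare moebius.simps [simp del]

end

theory Submission
  imports Defs
begin

text \<open>Write \<open>g(x, y)\<close> for the claimed value. It has to be shown that the sum of \<open>g(x, z)\<close> over
  \<open>x \<le> z \<le> y\<close> vanishes when \<open>x < y\<close>. Replacing \<open>ht\<close> by \<open>- ht\<close> reverses the Bruhat order and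
  preserves quasiparabolicity, so let \<open>ht\<close> be bounded from below. By the exchange property, a word
  leading from a point of minimal height in the orbit to \<open>y\<close> can be taken to raise the height by
  one at each letter; hence intervals are finite and \<open>s y < y\<close> for some \<open>s \<in> S\<close>.
  By QP2, both \<open>max(x, s x)\<close> and \<open>min(x, s x)\<close> are monotone in \<open>x\<close>. If \<open>x < s x\<close>, then \<open>s\<close>
  permutes the interval and \<open>g(x, s z) = - g(x, z)\<close>. If \<open>s x \<le> x\<close>, then the points \<open>z\<close> with
  \<open>s z < z\<close> contribute equally to the sums over \<open>[x, y]\<close> and \<open>[x, s y]\<close>, while all other points
  of \<open>[x, y]\<close> lie below \<open>s y\<close>; so induction on the height of \<open>y\<close> applies.\<close>

section \<open>Moebius functions of locally finite orders\<close>

lemma locally_finite_orderD: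
  assumes "locally_finite_order r"
  shows "antisym r" "trans r" "(x, y) \<in> r \<Longrightarrow> (x, x) \<in> r" "(x, y) \<in> r \<Longrightarrow> (y, y) \<in> r"
    "finite {z. (x, z) \<in> r \<and> (z, y) \<in> r}"
proof -
  have "Partial_order r" "finite {z. (x, z) \<in> r \<and> (z, y) \<in> r}"
    using assms by (auto simp: locally_finite_order_def)
  moreover from this have "refl_on (Field r) r" "trans r" "antisym r"
    using partial_order_onD[of "Field r" r] by auto
  ultimately show "antisym r" "trans r"
    "(x, y) \<in> r \<Longrightarrow> (x, x) \<in> r" "(x, y) \<in> r \<Longrightarrow> (y, y) \<in> r"
    "finite {z. (x, z) \<in> r \<and> (z, y) \<in> r}"
    by (auto intro: refl_onD FieldI1 FieldI2)
qed

lemma moebius_outside: "(x, y) \<notin> r \<Longrightarrow> moebius r x y = 0"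
  by (simp add: moebius.simps)

lemma moebius_sum:
  assumes "locally_finite_order r" "(x, y) \<in> r"
  shows "(\<Sum>z | (x, z) \<in> r \<and> (z, y) \<in> r. moebius r x z) = (if x = y then 1 else 0)"
proof -
  note D = locally_finite_orderD[OF assms(1)]
  let ?I = "{z. (x, z) \<in> r \<and> (z, y) \<in> r}"
  show ?thesis
  proof (cases "x = y")
    case True
    then have "?I = {x}" using assms(2) D(1) by (auto dest: antisymD)
    then show ?thesis using True assms by (simp add: moebius.simps)
  next
    case False
    have "y \<in> ?I" using assms(2) D(4) by auto
    then have "(\<Sum>z\<in>?I. moebius r x z) = moebius r x y + (\<Sum>z\<in>?I - {y}. moebius r x z)"
      using D(5) by (rule sum.remove[rotated])
    moreover have "?I - {y} = {z. (x, z) \<in> r \<and> (z, y) \<in> r \<and> z \<noteq> y}" by auto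
    ultimately show ?thesis using False assms by (simp add: moebius.simps[of r x y])
  qed
qed

text \<open>With the lower end \<open>x\<close> fixed, each summation identity expresses
  \<open>f y\<close> through values at points whose interval above \<open>x\<close> is strictly
  smaller, so it determines \<open>f\<close> recursively.\<close>

lemma moebius_unique:
  assumes "locally_finite_order r"
    and sum: "\<And>y. (x, y) \<in> r \<Longrightarrow>
      (\<Sum>z | (x, z) \<in> r \<and> (z, y) \<in> r. f z) = (if x = y then 1 else 0)"
    and "(x, y) \<in> r"
  shows "moebius r x y = f y"
  using assms(3)
proof (induction "card {z. (x, z) \<in> r \<and> (z, y) \<in> r}" arbitrary: y rule: less_induct)
  case less
  note D = locally_finite_orderD[OF assms(1)]
  let ?I = "\<lambda>y. {z. (x, z) \<in> r \<and> (z, y) \<in> r}"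
  have yI: "y \<in> ?I y" using less.prems D(4) by auto
  have "moebius r x z = f z" if "z \<in> ?I y - {y}" for z
  proof (rule less.hyps)
    have "?I z \<subset> ?I y"
      using that yI transD[OF D(2)] antisymD[OF D(1)] by blast
    then show "card (?I z) < card (?I y)" using D(5) by (rule psubset_card_mono[rotated])
  qed (use that in auto)
  then have "(\<Sum>z\<in>?I y - {y}. moebius r x z) = (\<Sum>z\<in>?I y - {y}. f z)"
    by (intro sum.cong) auto
  moreover have "(\<Sum>z\<in>?I y. moebius r x z) = (\<Sum>z\<in>?I y. f z)"
    using moebius_sum[OF assms(1) less.prems] sum[OF less.prems] by simp
  ultimately show ?case
    using sum.remove[OF D(5) yI, of "moebius r x"] sum.remove[OF D(5) yI, of f] by simp
qed

text \<open>A one-sided inverse of the zeta function in the incidence algebra is two-sided.\<close>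

lemma moebius_unique_dual:
  assumes lf: "locally_finite_order r"
    and sum: "\<And>x. (x, y) \<in> r \<Longrightarrow>
      (\<Sum>z | (x, z) \<in> r \<and> (z, y) \<in> r. f z) = (if x = y then 1 else 0)"
    and xy: "(x, y) \<in> r"
  shows "moebius r x y = f x"
proof -
  note D = locally_finite_orderD[OF lf]
  let ?I = "{z. (x, z) \<in> r \<and> (z, y) \<in> r}"
  have y: "y \<in> ?I" and x: "x \<in> ?I" using xy D(3,4) by auto
  have "moebius r x y = (\<Sum>z\<in>?I. moebius r x z * (if z = y then 1 else 0))"
    using y D(5) by (simp add: if_distrib[of "(*) _"] sum.delta cong: if_cong)
  \<comment> \<open>The indicator of \<open>z = y\<close> is expanded into the interval sum of
    \<open>f\<close>. After the order of summation is exchanged, the inner sum is the defining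
    identity of \<open>moebius\<close> on the interval from \<open>x\<close> to
    \<open>w\<close>.\<close>
  also have "\<dots> = (\<Sum>z\<in>?I. moebius r x z * (\<Sum>w | (z, w) \<in> r \<and> (w, y) \<in> r. f w))"
    using sum by (intro sum.cong) auto
  also have "\<dots> = (\<Sum>z\<in>?I. \<Sum>w | w \<in> ?I \<and> (z, w) \<in> r. moebius r x z * f w)"
    unfolding sum_distrib_left
    by (intro sum.cong) (auto intro: transD[OF D(2)])
  also have "\<dots> = (\<Sum>w\<in>?I. \<Sum>z | z \<in> ?I \<and> (z, w) \<in> r. moebius r x z * f w)"
    by (rule sum.swap_restrict[OF D(5) D(5)])
  also have "\<dots> = (\<Sum>w\<in>?I. (\<Sum>z | (x, z) \<in> r \<and> (z, w) \<in> r. moebius r x z) * f w)"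
    unfolding sum_distrib_right
    by (intro sum.cong) (auto intro: transD[OF D(2)])
  also have "\<dots> = (\<Sum>w\<in>?I. (if x = w then 1 else 0) * f w)"
    using moebius_sum[OF lf] by (intro sum.cong) auto
  also have "\<dots> = (\<Sum>w\<in>?I. if x = w then f w else 0)"
    by (intro sum.cong) auto
  also have "\<dots> = f x"
    using x D(5) by (simp add: sum.delta)
  finally show ?thesis .
qed


section \<open>Reflection actions and the Bruhat order\<close>

text \<open>Only the action of the reflections \<open>R\<close> on \<open>E\<close> matters. Conjugation by \<open>S\<close> is required to
  preserve \<open>R\<close> only up to this action.\<close>

locale qp_set =
  fixes S R :: "'a set" and E :: "'b set" and act :: "'a \<Rightarrow> 'b \<Rightarrow> 'b" and ht :: "'b \<Rightarrow> int"
  assumes finite_S: "finite S"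
    and S_subset_R: "S \<subseteq> R"
    and act_closed [simp]: "r \<in> R \<Longrightarrow> x \<in> E \<Longrightarrow> act r x \<in> E"
    and act_act [simp]: "r \<in> R \<Longrightarrow> x \<in> E \<Longrightarrow> act r (act r x) = x"
    and conj: "s \<in> S \<Longrightarrow> r \<in> R \<Longrightarrow> \<exists>r'\<in>R. \<forall>x\<in>E. act r' x = act s (act r (act s x))"
    and word: "r \<in> R \<Longrightarrow> \<exists>ws\<in>lists S. \<forall>x\<in>E. act r x = foldr act ws x"
    and scaled: "s \<in> S \<Longrightarrow> x \<in> E \<Longrightarrow> \<bar>ht (act s x) - ht x\<bar> \<le> 1"
    and QP1: "r \<in> R \<Longrightarrow> x \<in> E \<Longrightarrow> ht (act r x) = ht x \<Longrightarrow> act r x = x"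
    and QP2: "r \<in> R \<Longrightarrow> x \<in> E \<Longrightarrow> s \<in> S \<Longrightarrow> ht x < ht (act r x) \<Longrightarrow>
      ht (act s (act r x)) < ht (act s x) \<Longrightarrow> act r x = act s x"
begin

text \<open>QP2 for \<open>- ht\<close> at \<open>x\<close> is QP2 for \<open>ht\<close> at
  \<open>act r x\<close>; it yields \<open>x = act s (act r x)\<close>, and applying
  \<open>s\<close> gives the claim. Order-theoretic lemmas thereby acquire mirror images with the
  two ends exchanged.\<close>

lemma dual: "qp_set S R E act (\<lambda>x. - ht x)"
proof
  fix r x s
  assume r: "r \<in> R" and x: "x \<in> E" and s: "s \<in> S"
    and "- ht x < - ht (act r x)" "- ht (act s (act r x)) < - ht (act s x)"
  then have "act r (act r x) = act s (act r x)"
    by (intro QP2) auto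
  then show "act r x = act s x"
    using r x s S_subset_R by (metis act_act act_closed subsetD)
qed (use finite_S S_subset_R conj word QP1 in auto,
    use scaled in \<open>force simp: abs_le_iff\<close>)

lemma S_in_R [simp]: "s \<in> S \<Longrightarrow> s \<in> R"
  using S_subset_R by auto

lemma act_eq_iff: "r \<in> R \<Longrightarrow> x \<in> E \<Longrightarrow> y \<in> E \<Longrightarrow> act r x = act r y \<longleftrightarrow> x = y"
  by (metis act_act)

definition up_step :: "'b \<Rightarrow> 'b \<Rightarrow> bool" where
  "up_step x y \<longleftrightarrow> x \<in> E \<and> ht x < ht y \<and> (\<exists>r\<in>R. y = act r x)"

text \<open>The reflexive closure also relates points outside \<open>E\<close> to themselves; the
  first conjunct confines the order to \<open>E\<close>.\<close>

definition le :: "'b \<Rightarrow> 'b \<Rightarrow> bool"  (infix "\<preceq>" 50) where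
  "x \<preceq> y \<longleftrightarrow> x \<in> E \<and> up_step\<^sup>*\<^sup>* x y"

text \<open>Only the even step of the chain is kept. The parts before and after it are compressed to
  order relations, which makes monotonicity in both ends immediate.\<close>

definition has_even_chain :: "'b \<Rightarrow> 'b \<Rightarrow> bool" where
  "has_even_chain x y \<longleftrightarrow>
     (\<exists>u v. x \<preceq> u \<and> up_step u v \<and> even (ht v - ht u) \<and> v \<preceq> y)"

text \<open>The candidate value, written \<open>g\<close> in the overview. Heights do not decrease
  along \<preceq>, so \<open>nat\<close> truncates nothing.\<close>

definition mu :: "'b \<Rightarrow> 'b \<Rightarrow> int" where
  "mu x y = (if x \<preceq> y \<and> \<not> has_even_chain x y then (-1) ^ nat (ht y - ht x) else 0)"

lemma up_stepD:
  assumes "up_step x y"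
  shows "x \<in> E" "y \<in> E" "ht x < ht y" "x \<noteq> y"
  using assms by (auto simp: up_step_def)

lemma le_refl: "x \<in> E \<Longrightarrow> x \<preceq> x"
  by (simp add: le_def)

lemma up_step_le: "up_step x y \<Longrightarrow> x \<preceq> y"
  by (auto simp: le_def up_stepD)

lemma le_in:
  assumes "x \<preceq> y" shows "x \<in> E" "y \<in> E"
proof -
  have "up_step\<^sup>*\<^sup>* x y" "x \<in> E" using assms by (auto simp: le_def)
  then show "x \<in> E" "y \<in> E" by (induction) (auto simp: up_stepD)
qed

lemma le_trans [trans]: "x \<preceq> y \<Longrightarrow> y \<preceq> z \<Longrightarrow> x \<preceq> z"
  by (auto simp: le_def)

lemma le_ht:
  assumes "x \<preceq> y" shows "x = y \<or> ht x < ht y"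
proof -
  have "up_step\<^sup>*\<^sup>* x y" using assms by (auto simp: le_def)
  then show ?thesis by (induction) (auto dest: up_stepD)
qed

lemma le_antisym: "x \<preceq> y \<Longrightarrow> y \<preceq> x \<Longrightarrow> x = y"
  using le_ht[of x y] le_ht[of y x] by auto

lemma le_act: "r \<in> R \<Longrightarrow> x \<in> E \<Longrightarrow> ht x \<le> ht (act r x) \<Longrightarrow> x \<preceq> act r x"
  using QP1[of r x] up_step_le[of x "act r x"] le_refl[of x]
  by (fastforce simp: up_step_def)

lemma act_le: "r \<in> R \<Longrightarrow> x \<in> E \<Longrightarrow> ht (act r x) \<le> ht x \<Longrightarrow> act r x \<preceq> x"
  using le_act[of r "act r x"] by simp

lemma dual_up_step: "qp_set.up_step R E act (\<lambda>x. - ht x) x y \<longleftrightarrow> up_step y x"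
  unfolding qp_set.up_step_def[OF dual] up_step_def
  by (metis act_act act_closed neg_less_iff_less)

lemma dual_le: "qp_set.le R E act (\<lambda>x. - ht x) x y \<longleftrightarrow> y \<preceq> x"
proof -
  have "qp_set.up_step R E act (\<lambda>x. - ht x) = up_step\<inverse>\<inverse>"
    by (intro ext) (simp add: dual_up_step)
  then have "qp_set.le R E act (\<lambda>x. - ht x) x y \<longleftrightarrow> x \<in> E \<and> up_step\<^sup>*\<^sup>* y x"
    unfolding qp_set.le_def[OF dual] by (simp add: rtranclp_conversep)
  then show ?thesis
    using le_in[of y x] unfolding le_def by (metis converse_rtranclpE up_stepD(1))
qed

lemma dual_has_even_chain:
  "qp_set.has_even_chain R E act (\<lambda>x. - ht x) x y \<longleftrightarrow> has_even_chain y x"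
  unfolding qp_set.has_even_chain_def[OF dual] has_even_chain_def dual_le dual_up_step
  by fastforce

lemma dual_mu: "qp_set.mu R E act (\<lambda>x. - ht x) x y = mu y x"
  unfolding qp_set.mu_def[OF dual] mu_def dual_le dual_has_even_chain by simp

text \<open>QP2 prevents \<open>s\<close> from reversing the two heights unless it swaps the points.
  The images are related by the conjugate reflection \<open>r'\<close>, so by QP1 equal heights
  would force equal points.\<close>

lemma up_step_act:
  assumes "s \<in> S" "up_step u v" "v \<noteq> act s u"
  shows "up_step (act s u) (act s v)"
proof -
  obtain r where r: "r \<in> R" "v = act r u" and u: "u \<in> E" "ht u < ht v"
    using assms by (auto simp: up_step_def)
  obtain r' where r': "r' \<in> R" "\<forall>x\<in>E. act r' x = act s (act r (act s x))"
    using conj assms(1) r by blast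
  then have eq: "act r' (act s u) = act s v" using assms r u by auto
  have "ht (act s u) \<le> ht (act s v)"
    using QP2[of r u s] r u assms(1,3) by force
  moreover have "act s u \<noteq> act s v"
    using u assms r by (metis S_in_R act_closed act_eq_iff less_irrefl)
  ultimately have "ht (act s u) < ht (act s v)"
    using QP1[of r' "act s u"] eq r' u assms by force
  then show ?thesis using eq r' u assms(1) unfolding up_step_def
    by (metis S_in_R act_closed)
qed

text \<open>\<open>up s x\<close> and \<open>down s x\<close> are the larger and the smaller of
  \<open>x\<close> and \<open>act s x\<close> in the Bruhat order. In a tie of heights both branches
  agree by QP1.\<close>

definition up :: "'a \<Rightarrow> 'b \<Rightarrow> 'b" where
  "up s x = (if ht x \<le> ht (act s x) then act s x else x)"

definition down :: "'a \<Rightarrow> 'b \<Rightarrow> 'b" where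
  "down s x = (if ht (act s x) \<le> ht x then act s x else x)"

lemma le_up: "s \<in> S \<Longrightarrow> x \<in> E \<Longrightarrow> x \<preceq> up s x" "s \<in> S \<Longrightarrow> x \<in> E \<Longrightarrow> act s x \<preceq> up s x"
  by (auto simp: up_def le_act act_le le_refl)

text \<open>A single step from \<open>u\<close> to \<open>v\<close> suffices. If \<open>s\<close>
  swaps the two points, both values are \<open>v\<close>; otherwise \<open>s\<close> carries the
  step to a step, and both \<open>u\<close> and \<open>act s u\<close> lie below
  \<open>up s v\<close>.\<close>

lemma up_mono:
  assumes s: "s \<in> S" and xy: "x \<preceq> y"
  shows "up s x \<preceq> up s y"
proof -
  have up_le: "up s u \<preceq> up s v" if uv: "up_step u v" for u v
  proof (cases "v = act s u")
    case True
    then have "up s u = v" "up s v = v"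
      using up_stepD[OF uv] s by (auto simp: up_def)
    then show ?thesis using up_stepD[OF uv] by (simp add: le_refl)
  next
    case False
    have "v \<preceq> up s v" "act s v \<preceq> up s v" using le_up s up_stepD[OF uv] by auto
    moreover have "u \<preceq> v" "act s u \<preceq> act s v"
      using up_step_act[OF s uv False] uv up_step_le by auto
    ultimately show ?thesis unfolding up_def[of s u] by (auto intro: le_trans)
  qed
  have "up_step\<^sup>*\<^sup>* x y" "x \<in> E" using xy by (auto simp: le_def)
  then show ?thesis
  proof (induction)
    case base
    then show ?case using s by (simp add: up_def le_refl)
  next
    case (step y z)
    then show ?case using up_le le_trans by blast
  qed
qed

lemma down_mono: "s \<in> S \<Longrightarrow> x \<preceq> y \<Longrightarrow> down s x \<preceq> down s y"
  using qp_set.up_mono[OF dual, of s y x] unfolding dual_le qp_set.up_def[OF dual] down_def by simp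

lemma down_le: "s \<in> S \<Longrightarrow> x \<in> E \<Longrightarrow> down s x \<preceq> x" "s \<in> S \<Longrightarrow> x \<in> E \<Longrightarrow> down s x \<preceq> act s x"
  by (auto simp: down_def le_act act_le le_refl)

section \<open>Even steps under simple reflections\<close>

lemma has_even_chain_mono:
  "x \<preceq> x' \<Longrightarrow> has_even_chain x' y' \<Longrightarrow> y' \<preceq> y \<Longrightarrow> has_even_chain x y"
  unfolding has_even_chain_def by (meson le_trans)

lemma has_even_chain_step: "up_step u v \<Longrightarrow> even (ht v - ht u) \<Longrightarrow> has_even_chain u v"
  unfolding has_even_chain_def using le_refl up_stepD by blast

text \<open>A discrete intermediate value principle. It serves to find the step of a chain at which
  points moved by \<open>s\<close> give way to a point fixed by \<open>s\<close>.\<close>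

lemma le_switch:
  assumes "x \<preceq> z" "\<not> P x" "P z"
  shows "\<exists>u v. x \<preceq> u \<and> up_step u v \<and> v \<preceq> z \<and> \<not> P u \<and> P v"
proof -
  have "up_step\<^sup>*\<^sup>* x z" "x \<in> E" using assms by (auto simp: le_def)
  then show ?thesis using assms(2,3)
  proof (induction rule: converse_rtranclp_induct)
    case (step x y)
    show ?case
    proof (cases "P y")
      case True
      have "y \<preceq> z" using step up_stepD by (auto simp: le_def)
      then show ?thesis using True step le_refl by blast
    next
      case False
      then obtain u v where "y \<preceq> u \<and> up_step u v \<and> v \<preceq> z \<and> \<not> P u \<and> P v"
        using step up_stepD by blast
      then show ?thesis using step.hyps up_step_le le_trans by blast
    qed
  qed simp
qed

lemma ht_act_cases:
  assumes "s \<in> S" "x \<in> E"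
  obtains "act s x = x" | "ht (act s x) = ht x + 1" | "ht (act s x) = ht x - 1"
  using scaled[OF assms] QP1[OF S_in_R[OF assms(1)] assms(2)] by linarith

text \<open>A chain from \<open>x\<close> to \<open>z\<close> contains a step from some \<open>u\<close> moved by \<open>s\<close> to some \<open>v\<close> fixed by \<open>s\<close>;
  then \<open>u < v\<close> and \<open>s u < v\<close> are both reflection steps, and their heights have different parity.\<close>

lemma has_even_chain_fixed_top:
  assumes s: "s \<in> S" and xz: "x \<preceq> z" and x: "ht x < ht (act s x)" and z: "act s z = z"
  shows "has_even_chain x z"
proof -
  have E: "x \<in> E" "z \<in> E" using le_in[OF xz] by auto
  have "act s x \<noteq> x" using x by auto
  then obtain u v where uv: "x \<preceq> u" "up_step u v" "v \<preceq> z" "act s u \<noteq> u" "act s v = v"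
    using le_switch[OF xz, of "\<lambda>w. act s w = w"] z by auto
  note uE = up_stepD[OF uv(2)]
  have "v \<noteq> act s u" using uv s uE by (metis S_in_R act_act)
  then have suv: "up_step (act s u) v" using up_step_act[OF s uv(2)] uv(5) by simp
  show ?thesis
  proof (cases "even (ht v - ht u)")
    case True
    then show ?thesis using has_even_chain_step uv has_even_chain_mono by blast
  next
    case False
    from s uE(1) have "even (ht v - ht (act s u))"
      by (cases rule: ht_act_cases) (use uv False in auto)
    then have *: "has_even_chain (act s u) v" using has_even_chain_step suv by simp
    \<comment> \<open>Since \<open>s\<close> is an ascent at \<open>x\<close>, \<open>x\<close> is
      its own image under \<open>down s\<close>, so everything above \<open>x\<close> stays above it
      when \<open>s\<close> is applied.\<close>
    have "x \<preceq> act s u"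
    proof -
      have "x = down s x" using x by (simp add: down_def)
      also have "\<dots> \<preceq> down s u" using down_mono s uv by simp
      also have "down s u \<preceq> act s u" using down_le s uE by simp
      finally show ?thesis .
    qed
    then show ?thesis using * uv(3) has_even_chain_mono by blast
  qed
qed

lemma has_even_chain_fixed_bottom:
  assumes "s \<in> S" "x \<preceq> z" "ht (act s z) < ht z" "act s x = x"
  shows "has_even_chain x z"
  using qp_set.has_even_chain_fixed_top[OF dual, of s z x] assms
  unfolding dual_le dual_has_even_chain by simp

text \<open>The even step from \<open>u\<close> to \<open>v\<close> is pushed below
  \<open>act s z\<close> by \<open>down s\<close>. If \<open>s\<close> fixes \<open>u\<close> or
  \<open>v\<close>, there is already an even chain from \<open>x\<close> to that point. Otherwise
  \<open>s\<close> carries the step to another even step, and one of the two fits between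
  \<open>down s u\<close> and \<open>down s v\<close>.\<close>

lemma has_even_chain_lower_top:
  assumes s: "s \<in> S" and xz: "has_even_chain x z"
    and x: "ht x < ht (act s x)" and z: "ht (act s z) < ht z"
  shows "has_even_chain x (act s z)"
proof -
  obtain u v where uv: "x \<preceq> u" "up_step u v" "even (ht v - ht u)" "v \<preceq> z"
    using xz by (auto simp: has_even_chain_def)
  note uE = up_stepD[OF uv(2)]
  have xd: "down s x = x" and zd: "down s z = act s z" using x z by (simp_all add: down_def)
  have le: "x \<preceq> down s u" "down s v \<preceq> act s z" "down s u \<preceq> act s z"
    using down_mono[OF s] uv up_step_le[OF uv(2)] le_trans xd zd by metis+
  consider "act s u = u" | "act s v = v" | "act s u \<noteq> u" "act s v \<noteq> v" by blast
  then show ?thesis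
  proof cases
    case 1
    then have "has_even_chain x u" using has_even_chain_fixed_top s uv x by blast
    moreover have "down s u = u" using 1 by (simp add: down_def)
    ultimately show ?thesis using le has_even_chain_mono le_refl le_in by metis
  next
    case 2
    then have "has_even_chain x v"
      using has_even_chain_fixed_top s uv x le_trans up_step_le by blast
    moreover have "down s v = v" using 2 by (simp add: down_def)
    ultimately show ?thesis using le has_even_chain_mono le_refl le_in by metis
  next
    case 3
    have hu: "ht (act s u) = ht u + 1 \<or> ht (act s u) = ht u - 1"
      using ht_act_cases s uE 3 by metis
    have hv: "ht (act s v) = ht v + 1 \<or> ht (act s v) = ht v - 1"
      using ht_act_cases s uE 3 by metis
    have par: "even (ht (act s v) - ht (act s u))" using hu hv uv(3) by auto
    \<comment> \<open>A step along \<open>s\<close> changes the height by one, so it is not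
      even.\<close>
    have "v \<noteq> act s u" using hu uv(3) by auto
    then have suv: "up_step (act s u) (act s v)" using up_step_act s uv by blast
    have e1: "has_even_chain u v" and e2: "has_even_chain (act s u) (act s v)"
      using has_even_chain_step uv suv par by auto
    have "has_even_chain (down s u) (down s v)"
    proof (cases "ht (act s v) < ht v")
      case True
      then have "down s v = act s v" by (simp add: down_def)
      moreover have "down s u \<preceq> act s u" using down_le s uE by simp
      ultimately show ?thesis using e2 has_even_chain_mono le_refl suv up_stepD(2) by metis
    next
      case False
      then have "down s v = v" using hv by (simp add: down_def)
      moreover have "down s u \<preceq> u" using down_le s uE by simp
      ultimately show ?thesis using e1 has_even_chain_mono le_refl uE by metis
    qed
    then show ?thesis using le has_even_chain_mono by blast
  qed
qed

lemma has_even_chain_raise_bottom: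
  assumes "s \<in> S" "has_even_chain x z" "ht x < ht (act s x)" "ht (act s z) < ht z"
  shows "has_even_chain (act s x) z"
  using qp_set.has_even_chain_lower_top[OF dual, of s z x] assms
  unfolding dual_le dual_has_even_chain by simp

text \<open>Lying above \<open>x\<close> is invariant under \<open>s\<close>. If \<open>s\<close>
  moves \<open>z\<close>, the parity of the height changes while the existence of an even chain does
  not; if \<open>s\<close> fixes \<open>z\<close>, an even chain makes both sides zero.\<close>

lemma mu_act_top:
  assumes s: "s \<in> S" and x: "x \<in> E" "ht x < ht (act s x)" and z: "z \<in> E"
  shows "mu x (act s z) = - mu x z"
proof -
  have le: "x \<preceq> act s z" if "x \<preceq> z" "z \<in> E" for z
  proof -
    have "x = down s x" using x by (simp add: down_def)
    also have "\<dots> \<preceq> down s z" using down_mono s that by simp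
    also have "down s z \<preceq> act s z" using down_le s that by simp
    finally show ?thesis .
  qed
  then have le_iff: "x \<preceq> act s z \<longleftrightarrow> x \<preceq> z"
    using s z by (metis S_in_R act_act act_closed)
  have main: "mu x (act s z) = - mu x z"
    if z: "z \<in> E" "ht (act s z) = ht z + 1" and xz: "x \<preceq> z" for z
  proof -
    have "z \<preceq> act s z" using le_act s z by simp
    then have "has_even_chain x (act s z) \<longleftrightarrow> has_even_chain x z"
      using has_even_chain_lower_top[OF s, of x "act s z"]
        has_even_chain_mono[of x x z "act s z"] le_refl z s x by auto
    moreover have "nat (ht (act s z) - ht x) = Suc (nat (ht z - ht x))"
      using z le_ht[OF xz] by auto
    ultimately show ?thesis using le[OF xz z(1)] xz unfolding mu_def by simp
  qed
  show ?thesis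
  proof (cases "x \<preceq> z")
    case False
    then show ?thesis using le_iff by (simp add: mu_def)
  next
    case True
    from s z show ?thesis
    proof (cases rule: ht_act_cases)
      case 1
      then show ?thesis using has_even_chain_fixed_top s True x by (simp add: mu_def)
    next
      case 2
      then show ?thesis using main z True by blast
    next
      case 3
      then show ?thesis using main[of "act s z"] z True s le_iff by simp
    qed
  qed
qed

lemma mu_fixed_bottom:
  "s \<in> S \<Longrightarrow> act s x = x \<Longrightarrow> ht (act s z) < ht z \<Longrightarrow> mu x z = 0"
  using has_even_chain_fixed_bottom by (auto simp: mu_def)

text \<open>The lifting property: for two points with common descent \<open>s\<close>, it follows
  from monotonicity of \<open>up s\<close> and \<open>down s\<close>.\<close>

lemma le_act_iff:
  assumes s: "s \<in> S" and x: "x \<in> E" "ht (act s x) < ht x" and z: "z \<in> E" "ht (act s z) < ht z"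
  shows "x \<preceq> z \<longleftrightarrow> act s x \<preceq> z" "x \<preceq> z \<longleftrightarrow> act s x \<preceq> act s z"
proof -
  have "x \<preceq> z \<Longrightarrow> act s x \<preceq> act s z" using down_mono[OF s, of x z] x z by (simp add: down_def)
  moreover have "act s x \<preceq> act s z \<Longrightarrow> act s x \<preceq> z"
    using act_le[of s z] s z le_trans by auto
  moreover have "act s x \<preceq> z \<Longrightarrow> x \<preceq> z"
    using up_mono[OF s, of "act s x" z] x z s by (simp add: up_def)
  ultimately show "x \<preceq> z \<longleftrightarrow> act s x \<preceq> z" "x \<preceq> z \<longleftrightarrow> act s x \<preceq> act s z" by blast+
qed

text \<open>Both heights drop by one, and even chains are transferred through the intermediate pair
  \<open>act s x\<close>, \<open>z\<close>.\<close>

lemma mu_act_act: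
  assumes s: "s \<in> S" and x: "x \<in> E" "ht (act s x) < ht x" and z: "z \<in> E" "ht (act s z) < ht z"
  shows "mu (act s x) (act s z) = mu x z"
proof -
  have le: "act s x \<preceq> x" "act s z \<preceq> z" using act_le s x z by auto
  have "has_even_chain (act s x) (act s z) \<longleftrightarrow> has_even_chain x z"
  proof
    assume "has_even_chain (act s x) (act s z)"
    then have "has_even_chain (act s x) z" using has_even_chain_mono le le_refl le_in by metis
    then show "has_even_chain x z"
      using has_even_chain_raise_bottom[OF s, of "act s x" z] s x z by simp
  next
    assume "has_even_chain x z"
    then have "has_even_chain (act s x) z" using has_even_chain_mono le le_refl le_in by metis
    then show "has_even_chain (act s x) (act s z)"
      using has_even_chain_lower_top[OF s, of "act s x" z] s x z by simp
  qed
  moreover have "ht (act s z) = ht z - 1" "ht (act s x) = ht x - 1"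
    using scaled[OF s x(1)] scaled[OF s z(1)] x z by auto
  ultimately show ?thesis using le_act_iff(2)[OF assms] by (simp add: mu_def)
qed

section \<open>Words, the exchange property and orbits\<close>

lemma foldr_act_in [simp]: "ws \<in> lists S \<Longrightarrow> x \<in> E \<Longrightarrow> foldr act ws x \<in> E"
  by (induction ws) auto

lemma foldr_act_rev [simp]:
  "ws \<in> lists S \<Longrightarrow> x \<in> E \<Longrightarrow> foldr act (rev ws) (foldr act ws x) = x"
  by (induction ws) auto

lemma foldr_act_ht: "ws \<in> lists S \<Longrightarrow> x \<in> E \<Longrightarrow> ht (foldr act ws x) \<le> ht x + int (length ws)"
proof (induction ws)
  case (Cons s ws)
  then show ?case using scaled[of s "foldr act ws x"] by auto
qed simp

lemma foldr_act_conj: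
  assumes "ws \<in> lists S" "r \<in> R"
  shows "\<exists>r'\<in>R. \<forall>x\<in>E. foldr act ws (act r x) = act r' (foldr act ws x)"
  using assms
proof (induction ws)
  case (Cons s ws)
  then obtain r' where r': "r' \<in> R" "\<forall>x\<in>E. foldr act ws (act r x) = act r' (foldr act ws x)"
    by auto
  moreover obtain r'' where "r'' \<in> R" "\<forall>x\<in>E. act r'' x = act s (act r' (act s x))"
    using conj[OF Cons.hyps(1) r'(1)] by blast
  ultimately show ?case using Cons by (intro bexI[of _ r'']) auto
qed auto

text \<open>Letters act from the right end of the list. By QP2 the images of \<open>x\<close> and
  \<open>act r x\<close> keep their order until some letter swaps them; there the image of
  \<open>act r x\<close> is the image of \<open>x\<close> under the word without that
  letter.\<close>

lemma exchange:
  assumes "ws \<in> lists S" "r \<in> R" "x \<in> E" "ht x < ht (act r x)"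
  shows "ht (foldr act ws x) < ht (foldr act ws (act r x)) \<or>
    (\<exists>vs\<in>lists S. length vs < length ws \<and> foldr act vs x = foldr act ws (act r x))"
  using assms(1)
proof (induction ws)
  case Nil
  then show ?case using assms by simp
next
  case (Cons s ws)
  then have s: "s \<in> S" and ws: "ws \<in> lists S" by auto
  define u where "u = foldr act ws x"
  define v where "v = foldr act ws (act r x)"
  obtain r' where r': "r' \<in> R" "v = act r' u"
    using foldr_act_conj[OF ws assms(2)] assms unfolding u_def v_def by blast
  have u: "u \<in> E" "v \<in> E" using ws assms unfolding u_def v_def by auto
  from Cons.IH consider "ht u < ht v"
    | vs where "vs \<in> lists S" "length vs < length ws" "foldr act vs x = v"
    unfolding u_def v_def by auto
  then show ?case
  proof cases
    case 1
    then have uv: "up_step u v" using u r' by (auto simp: up_step_def)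
    show ?thesis
    proof (cases "v = act s u")
      case True
      then have "foldr act (s # ws) (act r x) = foldr act ws x"
        using s u unfolding u_def v_def by simp
      then show ?thesis using ws by (intro disjI2 bexI[of _ ws]) auto
    next
      case False
      then show ?thesis using up_step_act[OF s uv] up_stepD(3) unfolding u_def v_def by auto
    qed
  next
    case 2
    then show ?thesis using s unfolding v_def by (intro disjI2 bexI[of _ "s # vs"]) auto
  qed
qed

text \<open>Each letter changes the height by at most one, so in the resulting word
  \<open>vs\<close> every letter raises it by one. A letter that fixes the current point is dropped;
  one that lowers the height is removed by \<open>exchange\<close>, and induction on the length
  applies.\<close>

lemma word_from_minimum:
  assumes y: "y \<in> E" and min: "\<And>r. r \<in> R \<Longrightarrow> ht y \<le> ht (act r y)" and "ws \<in> lists S"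
  shows "\<exists>vs\<in>lists S. length vs \<le> length ws \<and> foldr act vs y = foldr act ws y \<and>
    ht (foldr act ws y) = ht y + int (length vs)"
  using assms(3)
proof (induction "length ws" arbitrary: ws rule: less_induct)
  case less
  show ?case
  proof (cases ws)
    case Nil
    then show ?thesis by auto
  next
    case (Cons s ws')
    then have s: "s \<in> S" and ws': "ws' \<in> lists S" using less.prems by auto
    from less.hyps[OF _ ws'] Cons obtain vs where vs: "vs \<in> lists S" "length vs \<le> length ws'"
      "foldr act vs y = foldr act ws' y" "ht (foldr act ws' y) = ht y + int (length vs)"
      by auto
    define u where "u = foldr act vs y"
    have u: "u \<in> E" "ht u = ht y + int (length vs)"
      using vs foldr_act_in[OF vs(1) y] by (auto simp: u_def)
    have ws: "foldr act ws y = act s u" using Cons vs by (simp add: u_def)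
    from s u(1) show ?thesis
    proof (cases rule: ht_act_cases)
      case 1
      then show ?thesis using vs Cons ws u by (intro bexI[of _ vs]) (auto simp: u_def)
    next
      case 2
      then show ?thesis using vs Cons ws u s by (intro bexI[of _ "s # vs"]) (auto simp: u_def)
    next
      case 3
      \<comment> \<open>Moving \<open>s\<close> to the right through \<open>vs\<close> turns it into
        a reflection \<open>r\<close> at \<open>y\<close>, so \<open>act s u\<close> is the image of
        \<open>act r y\<close> under \<open>vs\<close>.\<close>
      obtain r where r: "r \<in> R" "\<forall>x\<in>E. foldr act (rev vs) (act s x) = act r (foldr act (rev vs) x)"
        using foldr_act_conj[of "rev vs" s] vs(1) s by fastforce
      have "foldr act (rev vs) (act s u) = act r y"
        using r(2) u(1) foldr_act_rev[OF vs(1) y] unfolding u_def by metis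
      moreover have "rev vs \<in> lists S" using vs(1) by auto
      ultimately have r_eq: "foldr act vs (act r y) = act s u"
        using foldr_act_rev[of "rev vs" "act s u"] s u by simp
      \<comment> \<open>If \<open>r\<close> fixed \<open>y\<close>, then \<open>s\<close> would fix
        \<open>u\<close>, against the drop in height. Minimality of \<open>y\<close> therefore makes
        \<open>r\<close> an ascent there, as \<open>exchange\<close> requires.\<close>
      have "act r y \<noteq> y" using r_eq 3 unfolding u_def by auto
      then have "ht y < ht (act r y)" using min[OF r(1)] QP1[OF r(1) y] by force
      from exchange[OF vs(1) r(1) y this] obtain vs' where
        vs': "vs' \<in> lists S" "length vs' < length vs" "foldr act vs' y = act s u"
        using 3 unfolding r_eq u_def by auto
      then have "length vs' < length ws" using vs(2) Cons by simp
      from less.hyps[OF this vs'(1)] this show ?thesis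
        unfolding ws vs'(3) by (meson less_imp_le_nat order_trans)
    qed
  qed
qed

text \<open>The group does not appear in the locale; words in the generators produce the same
  orbit.\<close>

definition orbit :: "'b \<Rightarrow> 'b set" where
  "orbit y = {foldr act ws y | ws. ws \<in> lists S}"

lemma orbit_trans:
  assumes "z \<in> orbit y" "w \<in> orbit z" shows "w \<in> orbit y"
proof -
  obtain vs ws where "vs \<in> lists S" "ws \<in> lists S" "z = foldr act vs y" "w = foldr act ws z"
    using assms by (auto simp: orbit_def)
  then have "w = foldr act (ws @ vs) y" "ws @ vs \<in> lists S" by auto
  then show ?thesis unfolding orbit_def by blast
qed

lemma orbit_sym:
  assumes "y \<in> E" "z \<in> orbit y" shows "y \<in> orbit z"
proof -
  obtain ws where ws: "ws \<in> lists S" "z = foldr act ws y"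
    using assms(2) unfolding orbit_def by blast
  then have "y = foldr act (rev ws) z" "rev ws \<in> lists S"
    using assms(1) by auto
  then show ?thesis unfolding orbit_def by blast
qed

lemma orbit_in: "y \<in> E \<Longrightarrow> z \<in> orbit y \<Longrightarrow> z \<in> E"
  unfolding orbit_def using foldr_act_in by blast

lemma act_orbit: "y \<in> E \<Longrightarrow> r \<in> R \<Longrightarrow> act r y \<in> orbit y"
  using word[of r] unfolding orbit_def by blast

lemma le_orbit:
  assumes "x \<preceq> y" shows "x \<in> orbit y"
proof -
  have "up_step\<^sup>*\<^sup>* x y" "x \<in> E" using assms by (auto simp: le_def)
  then have "y \<in> orbit x"
  proof (induction)
    case base
    show ?case unfolding orbit_def by (auto intro!: exI[of _ "[]"])
  next
    case (step y z)
    then show ?case using act_orbit orbit_trans unfolding up_step_def by blast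
  qed
  then show ?thesis using orbit_sym le_in[OF assms] by blast
qed

end

section \<open>Finite intervals and the summation identity for heights bounded from below\<close>

locale bounded_below_qp_set = qp_set +
  fixes B :: int
  assumes bounded_below: "x \<in> E \<Longrightarrow> B \<le> ht x"
begin

lemma orbit_minimum:
  assumes "y \<in> E"
  shows "\<exists>m\<in>E. y \<in> orbit m \<and> (\<forall>z\<in>orbit y. ht m \<le> ht z) \<and> (\<forall>r\<in>R. ht m \<le> ht (act r m))"
proof -
  have "y \<in> orbit y" unfolding orbit_def by (auto intro!: exI[of _ "[]"])
  \<comment> \<open>Subtracting the bound \<open>B\<close> makes the heights natural numbers, so a
    least one is attained.\<close>
  then obtain m where m: "m \<in> orbit y" "\<And>z. z \<in> orbit y \<Longrightarrow> nat (ht m - B) \<le> nat (ht z - B)"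
    using ex_has_least_nat[of "\<lambda>z. z \<in> orbit y" y "\<lambda>z. nat (ht z - B)"] by blast
  have *: "ht m \<le> ht z" if "z \<in> orbit y" for z
    using m(2)[OF that] bounded_below[OF orbit_in[OF assms that]] by simp
  have mE: "m \<in> E" using orbit_in assms m by blast
  have "ht m \<le> ht (act r m)" if "r \<in> R" for r
    by (rule *[OF orbit_trans[OF m(1) act_orbit[OF mE that]]])
  then show ?thesis using mE orbit_sym[OF assms m(1)] * by blast
qed

text \<open>A word of length \<open>ht y - ht m\<close> leads from a minimal point \<open>m\<close>
  of the orbit to \<open>y\<close>. It is nonempty because \<open>x\<close> lies in the same orbit
  strictly below \<open>y\<close>, and the letter acting last is a descent of
  \<open>y\<close>.\<close>

lemma ex_descent:
  assumes "x \<preceq> y" "x \<noteq> y"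
  shows "\<exists>s\<in>S. ht (act s y) < ht y"
proof -
  have y: "y \<in> E" by (rule le_in(2)[OF assms(1)])
  obtain m where m: "m \<in> E" "y \<in> orbit m" "\<And>z. z \<in> orbit y \<Longrightarrow> ht m \<le> ht z"
    "\<And>r. r \<in> R \<Longrightarrow> ht m \<le> ht (act r m)"
    using orbit_minimum[OF y] by blast
  obtain ws where ws: "ws \<in> lists S" "y = foldr act ws m"
    using m(2) unfolding orbit_def by blast
  obtain vs where
    vs: "vs \<in> lists S" "foldr act vs m = y" "ht y = ht m + int (length vs)"
    using word_from_minimum[OF m(1,4) ws(1)] unfolding ws(2)[symmetric] by blast
  have "ht m \<le> ht x" by (rule m(3)[OF le_orbit[OF assms(1)]])
  moreover have "ht x < ht y" using le_ht[OF assms(1)] assms(2) by blast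
  ultimately have "vs \<noteq> []" using vs(3) by auto
  then obtain s vs' where v: "vs = s # vs'" by (cases vs) auto
  then have s: "s \<in> S" and vs': "vs' \<in> lists S" using vs(1) by auto
  have "act s y = foldr act vs' m" using s foldr_act_in[OF vs' m(1)] vs(2) v by auto
  moreover have "ht (foldr act vs' m) < ht y" using foldr_act_ht[OF vs' m(1)] vs(3) v by simp
  ultimately have "ht (act s y) < ht y" by simp
  then show ?thesis using s by blast
qed

text \<open>All points below \<open>y\<close> are reached from one minimal point \<open>m\<close> by
  words of length at most \<open>ht y - ht m\<close>, and the finite alphabet \<open>S\<close>
  admits only finitely many of these.\<close>

lemma finite_interval: "finite {z. x \<preceq> z \<and> z \<preceq> y}"
proof (cases "y \<in> E")
  case False
  then have "{z. x \<preceq> z \<and> z \<preceq> y} = {}" using le_in(2) by blast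
  then show ?thesis by (simp only: finite.emptyI)
next
  case y: True
  obtain m where m: "m \<in> E" "y \<in> orbit m" "\<And>r. r \<in> R \<Longrightarrow> ht m \<le> ht (act r m)"
    using orbit_minimum[OF y] by blast
  let ?L = "{ws. set ws \<subseteq> S \<and> length ws \<le> nat (ht y - ht m)}"
  have "{z. x \<preceq> z \<and> z \<preceq> y} \<subseteq> (\<lambda>ws. foldr act ws m) ` ?L"
  proof
    fix z assume "z \<in> {z. x \<preceq> z \<and> z \<preceq> y}"
    then have z: "z \<preceq> y" by simp
    have "z \<in> orbit m" by (rule orbit_trans[OF m(2) le_orbit[OF z]])
    then obtain ws where ws: "ws \<in> lists S" "z = foldr act ws m" unfolding orbit_def by blast
    obtain vs where
      vs: "vs \<in> lists S" "foldr act vs m = z" "ht z = ht m + int (length vs)"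
      using word_from_minimum[OF m(1,3) ws(1)] unfolding ws(2)[symmetric] by blast
    have "ht z \<le> ht y" using le_ht[OF z] by auto
    then have "vs \<in> ?L" using vs(1,3) by auto
    then show "z \<in> (\<lambda>ws. foldr act ws m) ` ?L" unfolding vs(2)[symmetric] by (rule imageI)
  qed
  then show ?thesis
    by (rule finite_subset) (intro finite_imageI finite_lists_length_le finite_S)
qed

lemma sum_mu_interval_ascent:
  assumes s: "s \<in> S" and x: "ht x < ht (act s x)" and y: "ht (act s y) < ht y" and xy: "x \<preceq> y"
  shows "(\<Sum>z | x \<preceq> z \<and> z \<preceq> y. mu x z) = 0"
proof -
  let ?I = "{z. x \<preceq> z \<and> z \<preceq> y}"
  have E: "x \<in> E" "y \<in> E" using le_in xy by auto
  \<comment> \<open>Here \<open>x = down s x\<close> and \<open>y = up s y\<close>, so monotonicity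
    keeps \<open>act s z\<close> between the two ends.\<close>
  have stable: "act s z \<in> ?I" if "z \<in> ?I" for z
  proof -
    have zE: "z \<in> E" using that le_in by auto
    have "down s x \<preceq> down s z" "up s z \<preceq> up s y" using down_mono up_mono s that by auto
    moreover have "down s x = x" "up s y = y" using x y by (auto simp: down_def up_def)
    ultimately show ?thesis
      using le_trans[OF _ down_le(2)[OF s zE], of x] le_trans[OF le_up(2)[OF s zE], of y] by simp
  qed
  have "bij_betw (act s) ?I ?I"
    using stable act_act[OF S_in_R[OF s]] le_in(1)[of _ y]
    by (intro bij_betw_byWitness[where f' = "act s"]) auto
  then have "(\<Sum>z\<in>?I. mu x z) = (\<Sum>z\<in>?I. mu x (act s z))"
    by (rule sum.reindex_bij_betw[symmetric])
  also have "\<dots> = (\<Sum>z\<in>?I. - mu x z)"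
    using mu_act_top[OF s E(1) x] le_in by (intro sum.cong) auto
  also have "\<dots> = - (\<Sum>z\<in>?I. mu x z)" by (rule sum_negf)
  finally show ?thesis by simp
qed

text \<open>The lower end varies in the induction because a descent \<open>s\<close> at
  \<open>x\<close> requires the hypothesis for \<open>act s x\<close> as well as for
  \<open>x\<close>.\<close>

lemma sum_mu_interval:
  assumes "x \<preceq> y" "x \<noteq> y"
  shows "(\<Sum>z | x \<preceq> z \<and> z \<preceq> y. mu x z) = 0"
  using assms
proof (induction "nat (ht y - B)" arbitrary: x y rule: less_induct)
  case less
  note E = le_in[OF less.prems(1)]
  obtain s where s: "s \<in> S" "ht (act s y) < ht y" using ex_descent less.prems by blast
  have sR: "s \<in> R" using s by simp
  have sy: "act s y \<in> E" "act s y \<preceq> y" using s E act_le by auto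
  \<comment> \<open>If \<open>x'\<close> is not below \<open>act s y\<close>, the sum is empty, so
    only equality has to be excluded.\<close>
  have IH: "(\<Sum>z | x' \<preceq> z \<and> z \<preceq> act s y. mu x' z) = 0" if "x' \<noteq> act s y" for x'
  proof (cases "x' \<preceq> act s y")
    case True
    then show ?thesis
      using that s bounded_below[OF sy(1)] by (intro less.hyps) auto
  next
    case False
    then have "{z. x' \<preceq> z \<and> z \<preceq> act s y} = {}" using le_trans by blast
    then show ?thesis by (metis sum.empty)
  qed
  \<comment> \<open>\<open>U\<close> collects the points of an interval with descent
    \<open>s\<close>, and \<open>N\<close> the remaining ones.\<close>
  define U where "U a b = {z. a \<preceq> z \<and> z \<preceq> b \<and> ht (act s z) < ht z}" for a b
  define N where "N a b = {z. a \<preceq> z \<and> z \<preceq> b \<and> ht z \<le> ht (act s z)}" for a b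
  have fin: "finite (U a b)" "finite (N a b)" for a b
    using finite_interval by (auto simp: U_def N_def intro: finite_subset[rotated])
  have split: "(\<Sum>z | a \<preceq> z \<and> z \<preceq> b. f z) = sum f (U a b) + sum f (N a b)" for f :: "'b \<Rightarrow> int" and a b
    using fin by (subst sum.union_disjoint[symmetric]) (auto simp: U_def N_def intro!: sum.cong)
  \<comment> \<open>Such a \<open>z\<close> equals \<open>down s z\<close>, since a tie of heights
    means a fixed point, while \<open>down s y\<close> is \<open>act s y\<close>.\<close>
  have "z \<preceq> act s y" if "z \<preceq> y" "ht z \<le> ht (act s z)" for z
  proof -
    have "down s z = z"
      using that QP1[OF sR le_in(1)[OF that(1)]] by (auto simp: down_def)
    then show ?thesis using down_mono[OF s(1) that(1)] s by (simp add: down_def)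
  qed
  then have N: "N x y = N x (act s y)" using sy le_trans unfolding N_def by blast
  consider "ht x < ht (act s x)" | "act s x = x" | "ht (act s x) < ht x"
    using s(1) E(1) by (cases rule: ht_act_cases) auto
  then show ?case
  proof cases
    case 1
    then show ?thesis using sum_mu_interval_ascent s less.prems by blast
  next
    case 2
    have U0: "sum (mu x) (U x b) = 0" for b
      using mu_fixed_bottom[OF s(1) 2] by (intro sum.neutral) (auto simp: U_def)
    have "x \<noteq> act s y" using 2 s E sR less.prems by (metis act_act)
    then show ?thesis using IH[of x] N U0 by (simp add: split)
  next
    case 3
    have sx: "act s x \<in> E" "ht (act s x) < ht (act s (act s x))" using E sR 3 by auto
    \<comment> \<open>\<open>L\<close> is the image of \<open>U x y\<close> under \<open>s\<close>:
      by the lifting property, both ends of the interval move down with the points.\<close>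
    define L where "L = {z. act s x \<preceq> z \<and> z \<preceq> act s y \<and> ht z < ht (act s z)}"
    have "bij_betw (act s) L (U x y)"
    proof (rule bij_betw_byWitness[where f' = "act s"])
      show "\<forall>a\<in>L. act s (act s a) = a" "\<forall>a'\<in>U x y. act s (act s a') = a'"
        using sR le_in by (auto simp: L_def U_def)
      show "act s ` L \<subseteq> U x y"
      proof (rule image_subsetI)
        fix z assume z: "z \<in> L"
        then have "z \<in> E" using le_in by (auto simp: L_def)
        then show "act s z \<in> U x y"
          using z le_act_iff[OF s(1) E(1) 3, of "act s z"] sR
            le_act_iff[OF s(1) _ _ E(2) s(2), of "act s z"] by (simp add: L_def U_def)
      qed
      show "act s ` U x y \<subseteq> L"
      proof (rule image_subsetI)
        fix z assume z: "z \<in> U x y"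
        then have "z \<in> E" using le_in by (auto simp: U_def)
        then show "act s z \<in> L"
          using z le_act_iff[OF s(1) E(1) 3, of z] sR
            le_act_iff[OF s(1) _ _ E(2) s(2), of z] by (simp add: L_def U_def)
      qed
    qed
    then have "sum (mu x) (U x y) = (\<Sum>z\<in>L. mu x (act s z))"
      by (rule sum.reindex_bij_betw[symmetric])
    also have "\<dots> = (\<Sum>z\<in>L. mu (act s x) z)"
      using mu_act_act[OF s(1) E(1) 3] sR le_in
      by (intro sum.cong) (auto simp: L_def dest!: spec, metis act_act act_closed le_in(2))
    \<comment> \<open>The added points are fixed by \<open>s\<close>; an even chain from
      \<open>act s x\<close> leads to each of them, so they contribute zero.\<close>
    also have "\<dots> = sum (mu (act s x)) (N (act s x) (act s y))"
    proof (rule sum.mono_neutral_left)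
      show "\<forall>z\<in>N (act s x) (act s y) - L. mu (act s x) z = 0"
      proof
        fix z assume "z \<in> N (act s x) (act s y) - L"
        then have z: "act s x \<preceq> z" "ht (act s z) = ht z" by (auto simp: L_def N_def)
        then have "act s z = z" using QP1 sR le_in by blast
        then show "mu (act s x) z = 0"
          using has_even_chain_fixed_top[OF s(1) z(1) sx(2)] by (simp add: mu_def)
      qed
    qed (use fin in \<open>auto simp: L_def N_def\<close>)
    also have "\<dots> = - sum (mu (act s x)) (U (act s x) (act s y))"
    proof -
      have "act s x \<noteq> act s y" using act_eq_iff sR E less.prems by auto
      then show ?thesis using IH[of "act s x"] by (simp add: split)
    qed
    \<comment> \<open>Since \<open>s\<close> is an ascent at \<open>act s x\<close>, applying
      \<open>s\<close> to the upper argument absorbs the sign. Shifting both arguments back then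
      yields \<open>mu x z\<close>.\<close>
    also have "\<dots> = (\<Sum>z\<in>U (act s x) (act s y). mu (act s x) (act s z))"
      unfolding sum_negf[symmetric] using mu_act_top[OF s(1) sx] le_in
      by (intro sum.cong) (auto simp: U_def)
    also have "\<dots> = sum (mu x) (U x (act s y))"
    proof (rule sum.cong)
      show "U (act s x) (act s y) = U x (act s y)"
        using le_act_iff(1)[OF s(1) E(1) 3] le_in unfolding U_def by blast
      show "mu (act s x) (act s z) = mu x z" if "z \<in> U x (act s y)" for z
        using mu_act_act[OF s(1) E(1) 3] that le_in by (auto simp: U_def)
    qed
    finally have "sum (mu x) (U x y) = sum (mu x) (U x (act s y))" .
    moreover have "x \<noteq> act s y" using 3 s sR E by auto
    ultimately show ?thesis using IH[of x] N by (simp add: split)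
  qed
qed

end

section \<open>Identification with the Moebius function\<close>

context qp_set
begin

lemma mu_refl:
  assumes "x \<in> E" shows "mu x x = 1"
proof -
  have "\<not> has_even_chain x x"
    unfolding has_even_chain_def using le_antisym up_step_le le_trans up_stepD(4) by metis
  then show ?thesis using assms le_refl by (simp add: mu_def)
qed

lemma moebius_eq_mu:
  assumes bdd: "bounded_height E ht" and r_def: "r = {(x, y). x \<preceq> y}"
  shows "moebius r x y = mu x y"
proof (cases "x \<preceq> y")
  case False
  then show ?thesis using moebius_outside[of x y r] by (simp add: mu_def r_def)
next
  case xy: True
  have field: "Field r = E" using le_refl le_in by (auto simp: r_def Field_def)
  have po: "Partial_order r"
    unfolding partial_order_on_def preorder_on_def field
    using le_refl le_in le_trans le_antisym
    by (auto simp: r_def refl_on_def trans_def antisym_def)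
  have I: "{z. (a, z) \<in> r \<and> (z, b) \<in> r} = {z. a \<preceq> z \<and> z \<preceq> b}" for a b
    by (simp add: r_def)
  have one: "(\<Sum>z | a \<preceq> z \<and> z \<preceq> a. f z) = f a" if "a \<in> E" for a and f :: "'b \<Rightarrow> int"
  proof -
    have "{z. a \<preceq> z \<and> z \<preceq> a} = {a}" using le_antisym le_refl that by auto
    then show ?thesis by simp
  qed
  from bdd consider B where "\<forall>x\<in>E. B \<le> ht x" | B where "\<forall>x\<in>E. ht x \<le> B"
    unfolding bounded_height_def bdd_below_def bdd_above_def by auto
  then show ?thesis
  proof cases
    case 1
    then interpret bb: bounded_below_qp_set S R E act ht B by unfold_locales auto
    \<comment> \<open>Finiteness of intervals rules out the default value zero of
      \<open>moebius\<close>.\<close>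
    have "locally_finite_order r"
      unfolding locally_finite_order_def I using po bb.finite_interval by blast
    then show ?thesis
      by (rule moebius_unique[where f = "mu x"])
        (use xy one mu_refl bb.sum_mu_interval le_in in \<open>auto simp: r_def\<close>)
  next
    \<comment> \<open>Negating the height exchanges the ends, so the summation identity now runs
      over the lower argument of \<open>mu\<close>; this calls for the dual form of
      uniqueness.\<close>
    case 2
    interpret d: bounded_below_qp_set S R E act "\<lambda>x. - ht x" "- B"
      by (rule bounded_below_qp_set.intro[OF dual]) (use 2 in \<open>unfold_locales, auto\<close>)
    have fin: "finite {z. a \<preceq> z \<and> z \<preceq> b}" for a b
      using d.finite_interval[of b a] unfolding dual_le by (simp add: Collect_conj_eq Int_commute)
    have "(\<Sum>z | a \<preceq> z \<and> z \<preceq> b. mu z b) = 0" if "a \<preceq> b" "a \<noteq> b" for a b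
    proof -
      have "(\<Sum>z | z \<preceq> b \<and> a \<preceq> z. mu z b) = 0"
        using d.sum_mu_interval[of b a] that unfolding dual_le dual_mu by simp
      then show ?thesis by (simp add: Collect_conj_eq Int_commute)
    qed
    moreover have "locally_finite_order r"
      unfolding locally_finite_order_def I using po fin by blast
    ultimately show ?thesis
      by (intro moebius_unique_dual[where f = "\<lambda>z. mu z y"])
        (use xy one mu_refl le_in in \<open>auto simp: r_def\<close>)
  qed
qed

end


section \<open>From a Coxeter system to the action of its reflections\<close>

lemma quasiparabolic_imp_qp_set:
  assumes cox: "coxeter_system W S" and qp: "quasiparabolic W S E act ht"
  shows "qp_set S (reflections W S) E act ht"
proof -
  interpret W: group W using cox by (simp add: coxeter_system_def)
  interpret A: group_action W E act
    using qp by (simp add: quasiparabolic_def scaled_W_set_def)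
  have S: "S \<subseteq> carrier W" and gen: "generate W S = carrier W"
    using cox by (auto simp: coxeter_system_def has_presentation_def)
  have SS: "s \<otimes>\<^bsub>W\<^esub> s = \<one>\<^bsub>W\<^esub>" if "s \<in> S" for s
  proof -
    have "s [^]\<^bsub>W\<^esub> (2 :: nat) = \<one>\<^bsub>W\<^esub>"
      using W.pow_ord_eq_1[of s] that cox S unfolding coxeter_system_def by (metis subsetD)
    then show ?thesis using that S by (auto simp: numeral_2_eq_2)
  qed
  \<comment> \<open>Generators are involutions, so inverse letters can be replaced by letters of
    \<open>S\<close> when a group element is written as a word.\<close>
  then have inv_S: "inv\<^bsub>W\<^esub> s = s" if "s \<in> S" for s
    using that S W.inv_equality[of s s] by auto
  have act_one: "act \<one>\<^bsub>W\<^esub> x = x" if "x \<in> E" for x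
    using A.id_eq_one that by (metis restrict_apply')
  have R: "reflections W S \<subseteq> carrier W" using S by (auto simp: reflections_def)
  have word: "\<exists>ws\<in>lists S. \<forall>x\<in>E. act w x = foldr act ws x" if "w \<in> generate W S" for w
    using that
  proof induction
    case one
    then show ?case using act_one by (intro bexI[of _ "[]"]) auto
  next
    case (incl s)
    then show ?case by (intro bexI[of _ "[s]"]) auto
  next
    case (inv s)
    then show ?case using inv_S by (intro bexI[of _ "[s]"]) auto
  next
    case (eng g h)
    then obtain u v where u: "u \<in> lists S" "\<forall>x\<in>E. act g x = foldr act u x"
      and v: "v \<in> lists S" "\<forall>x\<in>E. act h x = foldr act v x" by blast
    have gh: "g \<in> carrier W" "h \<in> carrier W" using eng gen by auto
    have "act (g \<otimes>\<^bsub>W\<^esub> h) x = foldr act (u @ v) x" if "x \<in> E" for x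
    proof -
      have "act h x \<in> E" using A.element_image gh that by blast
      then show ?thesis using A.composition_rule[OF that gh] u v that by simp
    qed
    then show ?case using u v by (intro bexI[of _ "u @ v"]) auto
  qed
  show ?thesis
  proof
    show "finite S" using cox by (simp add: coxeter_system_def)
    have "s = \<one>\<^bsub>W\<^esub> \<otimes>\<^bsub>W\<^esub> s \<otimes>\<^bsub>W\<^esub> inv\<^bsub>W\<^esub> \<one>\<^bsub>W\<^esub>" if "s \<in> S" for s using that S by auto
    then show "S \<subseteq> reflections W S" unfolding reflections_def by blast
    fix r x s
    show "act r x \<in> E" if "r \<in> reflections W S" "x \<in> E"
      using that R A.element_image by blast
    show "act r (act r x) = x" if r: "r \<in> reflections W S" and x: "x \<in> E"
    proof -
      obtain w t where w: "w \<in> carrier W" and t: "t \<in> S" and r_eq: "r = w \<otimes>\<^bsub>W\<^esub> t \<otimes>\<^bsub>W\<^esub> inv\<^bsub>W\<^esub> w"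
        using r by (auto simp: reflections_def)
      have tc: "t \<in> carrier W" using t S by auto
      have "r \<otimes>\<^bsub>W\<^esub> r = w \<otimes>\<^bsub>W\<^esub> (t \<otimes>\<^bsub>W\<^esub> (inv\<^bsub>W\<^esub> w \<otimes>\<^bsub>W\<^esub> w) \<otimes>\<^bsub>W\<^esub> t) \<otimes>\<^bsub>W\<^esub> inv\<^bsub>W\<^esub> w"
        unfolding r_eq using w tc by (simp only: W.m_assoc W.m_closed W.inv_closed)
      also have "\<dots> = \<one>\<^bsub>W\<^esub>" using w tc SS[OF t] by simp
      finally show ?thesis using A.composition_rule[OF x, of r r] r R act_one[OF x] by auto
    qed
    show "\<exists>r'\<in>reflections W S. \<forall>x\<in>E. act r' x = act s (act r (act s x))"
      if s: "s \<in> S" and r: "r \<in> reflections W S"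
    proof -
      obtain w t where w: "w \<in> carrier W" and t: "t \<in> S" and r_eq: "r = w \<otimes>\<^bsub>W\<^esub> t \<otimes>\<^bsub>W\<^esub> inv\<^bsub>W\<^esub> w"
        using r by (auto simp: reflections_def)
      have c: "s \<in> carrier W" "t \<in> carrier W" "r \<in> carrier W" using s t r S R by auto
      have "s \<otimes>\<^bsub>W\<^esub> r \<otimes>\<^bsub>W\<^esub> s = (s \<otimes>\<^bsub>W\<^esub> w) \<otimes>\<^bsub>W\<^esub> t \<otimes>\<^bsub>W\<^esub> inv\<^bsub>W\<^esub> (s \<otimes>\<^bsub>W\<^esub> w)"
        unfolding r_eq using c w inv_S[OF s] by (simp add: W.m_assoc W.inv_mult_group)
      moreover have "s \<otimes>\<^bsub>W\<^esub> w \<in> carrier W" using c w by simp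
      ultimately have "s \<otimes>\<^bsub>W\<^esub> r \<otimes>\<^bsub>W\<^esub> s \<in> reflections W S" unfolding reflections_def using t by blast
      moreover have "act (s \<otimes>\<^bsub>W\<^esub> r \<otimes>\<^bsub>W\<^esub> s) x = act s (act r (act s x))" if x: "x \<in> E" for x
        using A.composition_rule[OF x, of "s \<otimes>\<^bsub>W\<^esub> r" s] A.element_image[OF c(1) x]
          A.composition_rule[of "act s x" s r] c by simp
      ultimately show ?thesis by blast
    qed
    show "\<exists>ws\<in>lists S. \<forall>x\<in>E. act r x = foldr act ws x" if "r \<in> reflections W S"
      using word that R gen by auto
  qed (use qp in \<open>auto simp: quasiparabolic_def scaled_W_set_def\<close>)
qed

section \<open>Chains as lists and the final formula\<close>

theorem corollary6p2:
  fixes W :: "('a, 'm) monoid_scheme" and S :: "'a set"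
    and E :: "'b set" and act :: "'a \<Rightarrow> 'b \<Rightarrow> 'b" and ht :: "'b \<Rightarrow> int"
    and x y :: 'b
  assumes "coxeter_system W S"
    and "quasiparabolic W S E act ht"
    and "bounded_height E ht"
    and "odd_W_set W S E act"
    and "x \<in> E" and "y \<in> E"
  shows "moebius (bruhat_order W S E act ht) x y =
    (if (x, y) \<notin> bruhat_order W S E act ht then 0
     else if \<exists>cs. reflection_chain W S E act ht cs \<and> hd cs = x \<and> last cs = y \<and>
               (\<exists>i. Suc i < length cs \<and> even (ht (cs ! Suc i) - ht (cs ! i)))
     then 0
     else (-1) ^ nat (ht y - ht x))"
proof -
  interpret qp_set S "reflections W S" E act ht
    by (rule quasiparabolic_imp_qp_set[OF assms(1,2)])
  write le (infix "\<sqsubseteq>" 50)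
  let ?r = "bruhat_order W S E act ht"
  let ?chain = "reflection_chain W S E act ht"
  have "{(x, act r x) | x r. x \<in> E \<and> r \<in> reflections W S \<and> ht x < ht (act r x)} =
      {(x, y). up_step x y}"
    by (auto simp: up_step_def)
  then have r_eq: "?r = {(x, y). x \<sqsubseteq> y}"
    using le_in unfolding bruhat_order_def le_def
    by (auto simp: Enum.rtranclp_rtrancl_eq)
  \<comment> \<open>Distinct comparable points have strictly increasing heights, so the links of a
    \<open>reflection_chain\<close> are precisely the upward reflection steps.\<close>
  have step: "(u, v) \<in> ?r \<and> u \<noteq> v \<and> (\<exists>r\<in>reflections W S. v = act r u) \<longleftrightarrow> up_step u v" for u v
    using le_ht[of u v] le_in[of u v] up_step_le[of u v] by (auto simp: r_eq up_step_def)
  have chain_iff: "?chain cs \<longleftrightarrow> cs \<noteq> [] \<and> set cs \<subseteq> E \<and> successively up_step cs" for cs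
    unfolding reflection_chain_def step ..
  have chain_append: "?chain (as @ bs)" if "?chain as" "?chain bs" "up_step (last as) (hd bs)" for as bs
    using that unfolding chain_iff by (auto simp: successively_append_iff)
  have ex_chain: "\<exists>cs. ?chain cs \<and> hd cs = u \<and> last cs = v" if "u \<sqsubseteq> v" for u v
  proof -
    have "up_step\<^sup>*\<^sup>* u v" "u \<in> E" using that by (auto simp: le_def)
    then show ?thesis
    proof (induction)
      case base
      then show ?case unfolding chain_iff by (intro exI[of _ "[u]"]) auto
    next
      case (step v w)
      then obtain cs where cs: "?chain cs" "hd cs = u" "last cs = v" by auto
      have "?chain [w]" using up_stepD step.hyps unfolding chain_iff by auto
      then have "?chain (cs @ [w])" using chain_append cs step.hyps by simp
      then show ?case using cs by (intro exI[of _ "cs @ [w]"]) (auto simp: chain_iff)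
    qed
  qed
  have chain_le: "hd cs \<sqsubseteq> last cs" if "?chain cs" for cs
    using that
  proof (induction cs)
    case (Cons c cs)
    then show ?case
      by (cases cs) (auto simp: chain_iff intro: le_refl le_trans up_step_le)
  qed (simp add: chain_iff)
  have "(\<exists>cs. ?chain cs \<and> hd cs = x \<and> last cs = y \<and>
      (\<exists>i. Suc i < length cs \<and> even (ht (cs ! Suc i) - ht (cs ! i)))) \<longleftrightarrow> has_even_chain x y"
    (is "?L \<longleftrightarrow> ?R")
  proof
    assume ?L
    then obtain cs i where cs: "?chain cs" "hd cs = x" "last cs = y"
      and i: "Suc i < length cs" "even (ht (cs ! Suc i) - ht (cs ! i))" by blast
    \<comment> \<open>The list is cut at its even link; the two pieces collapse to order
      relations.\<close>
    have "?chain (take (Suc i) cs)" "?chain (drop (Suc i) cs)"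
      and "up_step (cs ! i) (cs ! Suc i)"
    proof -
      have "successively up_step (take (Suc i) cs @ drop (Suc i) cs)"
        using cs unfolding chain_iff by simp
      then show "?chain (take (Suc i) cs)" "?chain (drop (Suc i) cs)"
        using cs i unfolding chain_iff successively_append_iff
        by (auto dest: in_set_takeD in_set_dropD)
      show "up_step (cs ! i) (cs ! Suc i)"
        using cs i unfolding chain_iff by (auto intro: successively_nth)
    qed
    moreover have "last (take (Suc i) cs) = cs ! i" "hd (drop (Suc i) cs) = cs ! Suc i"
        "last (drop (Suc i) cs) = y"
      using cs i by (auto simp: hd_drop_conv_nth take_Suc_conv_app_nth)
    moreover have "hd (take (Suc i) cs) = x" using cs by simp
    ultimately show ?R using chain_le i(2) unfolding has_even_chain_def by metis
  next
    assume ?R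
    then obtain u v where uv: "x \<sqsubseteq> u" "up_step u v" "even (ht v - ht u)" "v \<sqsubseteq> y"
      by (auto simp: has_even_chain_def)
    \<comment> \<open>Conversely, the order relations are expanded into lists, and the even link
      sits at their junction, index \<open>length as - 1\<close>.\<close>
    obtain as bs where as: "?chain as" "hd as = x" "last as = u"
      and bs: "?chain bs" "hd bs = v" "last bs = y"
      using ex_chain uv by meson
    have ne: "as \<noteq> []" "bs \<noteq> []" using as bs by (auto simp: chain_iff)
    have "?chain (as @ bs)" using chain_append as bs uv by simp
    moreover have "hd (as @ bs) = x" "last (as @ bs) = y" using as bs ne by auto
    moreover have "(as @ bs) ! (length as - 1) = u" "(as @ bs) ! Suc (length as - 1) = v"
      "Suc (length as - 1) < length (as @ bs)"
      using as bs ne by (auto simp: nth_append last_conv_nth hd_conv_nth)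
    ultimately show ?L using uv(3) by metis
  qed
  then show ?thesis
    using moebius_eq_mu[OF assms(3) r_eq, of x y] by (simp add: mu_def r_eq)
qed

end
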